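(* Let $\mathcal A=(\mathbf a_{i,j})\in\mathbb K_{p+}^{n\times n}$ be a nonnegative irreducible tubal matrix. If there exists a strongly positive tubal scalar $\mathbf a_{i,j}\in\mathbb K_{p+++}$ among the entries of $\mathcal A$, then: 1. $\rho(\mathcal A)>0$ is a t-eigenvalue of $\mathcal A$. 2. Every nonzero nonnegative t-eigenvector of $\mathcal A$ is strongly positive. 3. There is a strongly positive t-eigenvector corresponding to $\rho(\mathcal A)$; such a strongly positive t-eigenvector is unique up to a multiplicative constant. 4. If $\lambda$ is a t-eigenvalue of $\mathcal A$ with a nonzero nonnegative t-eigenvector, then $\lambda=\rho(\mathcal A)$.
   Context: Let $n,p\ge 1$ be integers. $\mathbb K_p=\mathbb R^{1\times1\times p}$ is the set of tubal scalars $\mathbf a$ with entries $\mathbf a^{(1)},\dots,\mathbf a^{(p)}$; the product (also used for complex entries) is circular convolution: $(\mathbf a*\mathbf b)^{(k)}=\sum_{i+j\equiv k+1\ (\mathrm{mod}\ p)}\mathbf a^{(i)}\mathbf b^{(j)}$. A tubal vector $X=(\mathbf x_i)\in\mathbb K_p^n=\mathbb R^{n\times1\times p}$ and a tubal matrix $\mathcal A=(\mathbf a_{i,j})\in\mathbb K_p^{n\times n}=\mathbb R^{n\times n\times p}$ have entries in $\mathbb K_p$, and $(\mathcal A*X)_i=\sum_{j=1}^n\mathbf a_{i,j}*\mathbf x_j$ (also for $X\in\mathbb C^{n\times1\times p}$). A tubal scalar is nonnegative if all its entries are $\ge0$, and strongly positive if all its entries are $>0$; the sets of these are $\mathbb K_{p+}$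 and $\mathbb K_{p+++}$; a tubal vector or matrix is nonnegative/strongly positive if all its tubal-scalar entries are (so $\mathbb K_{p+}^{n\times n}$ is the set of nonnegative tubal matrices). $\boldsymbol 0$ denotes the zero tubal scalar or vector. $\mathcal A$ is reducible if there is a nonempty proper subset $I\subset\{1,\dots,n\}$ with $\mathbf a_{i,j}=\boldsymbol 0$ for all $i\in I$, $j\notin I$; otherwise irreducible. A scalar $\lambda\in\mathbb C$ is a t-eigenvalue of $\mathcal A$ with t-eigenvector $X\in\mathbb C^{n\times1\times p}$, $X\ne\boldsymbol 0$, if $\mathcal A*X=\lambda X$. $\rho(\mathcal A)=\max\{|\lambda| : \lambda \text{ a t-eigenvalue of }\mathcal A\}$. *)

theory Defs
  imports Complex_Main "Jordan_Normal_Form.Matrix"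
begin

text \<open>
  A tubal scalar is a vector of dimension \<open>p\<close>; tubal vectors and tubal matrices are vectors and
  matrices of dimension \<open>n\<close> and \<open>n \<times> n\<close> whose entries are tubal scalars. Indices start at 0, so
  the entry written \<open>a\<^sup>(\<^sup>k\<^sup>)\<close> with \<open>1 \<le> k \<le> p\<close> is \<open>a $ (k - 1)\<close>, and the condition
  \<open>i + j = k + 1 (mod p)\<close> on 1-based indices becomes \<open>i + j = k (mod p)\<close>.
\<close>

type_synonym 'a tscalar = "'a vec"
type_synonym 'a tvec = "'a vec vec"
type_synonym 'a tmat = "'a vec mat"

definition carrier_tvec :: "nat \<Rightarrow> nat \<Rightarrow> 'a tvec set" where
  "carrier_tvec n p = {X \<in> carrier_vec n. \<forall>i<n. X $ i \<in> carrier_vec p}"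

definition zero_tvec :: "nat \<Rightarrow> nat \<Rightarrow> 'a::zero tvec" where
  "zero_tvec n p = vec n (\<lambda>_. 0\<^sub>v p)"

definition smult_tvec :: "'a::times \<Rightarrow> 'a tvec \<Rightarrow> 'a tvec" where
  "smult_tvec c X = map_vec (\<lambda>x. c \<cdot>\<^sub>v x) X"

definition tscalar_mult :: "nat \<Rightarrow> 'a::semiring_0 tscalar \<Rightarrow> 'a tscalar \<Rightarrow> 'a tscalar" where
  "tscalar_mult p a b =
     vec p (\<lambda>k. \<Sum>(i, j) \<in> {(i, j). i < p \<and> j < p \<and> (i + j) mod p = k}. a $ i * b $ j)"

text \<open>
  The sum over \<open>j\<close> of the tubal scalars \<open>a\<^sub>i\<^sub>j * x\<^sub>j\<close> is taken componentwise.
\<close>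

definition tmat_mult_tvec :: "nat \<Rightarrow> nat \<Rightarrow> 'a::semiring_0 tmat \<Rightarrow> 'a tvec \<Rightarrow> 'a tvec" where
  "tmat_mult_tvec n p A X =
     vec n (\<lambda>i. vec p (\<lambda>k. \<Sum>j<n. tscalar_mult p (A $$ (i, j)) (X $ j) $ k))"

definition nonneg_tscalars :: "nat \<Rightarrow> real tscalar set" where
  "nonneg_tscalars p = {a \<in> carrier_vec p. \<forall>k<p. 0 \<le> a $ k}"

definition strongly_pos_tscalars :: "nat \<Rightarrow> real tscalar set" where
  "strongly_pos_tscalars p = {a \<in> carrier_vec p. \<forall>k<p. 0 < a $ k}"

definition nonneg_tvecs :: "nat \<Rightarrow> nat \<Rightarrow> real tvec set" where
  "nonneg_tvecs n p = {X \<in> carrier_vec n. \<forall>i<n. X $ i \<in> nonneg_tscalars p}"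

definition strongly_pos_tvecs :: "nat \<Rightarrow> nat \<Rightarrow> real tvec set" where
  "strongly_pos_tvecs n p = {X \<in> carrier_vec n. \<forall>i<n. X $ i \<in> strongly_pos_tscalars p}"

definition nonneg_tmats :: "nat \<Rightarrow> nat \<Rightarrow> real tmat set" where
  "nonneg_tmats n p =
     {A \<in> carrier_mat n n. \<forall>i<n. \<forall>j<n. A $$ (i, j) \<in> nonneg_tscalars p}"

definition t_reducible :: "nat \<Rightarrow> nat \<Rightarrow> 'a::zero tmat \<Rightarrow> bool" where
  "t_reducible n p A \<longleftrightarrow>
     (\<exists>I. I \<noteq> {} \<and> I \<subset> {..<n} \<and> (\<forall>i\<in>I. \<forall>j\<in>{..<n} - I. A $$ (i, j) = 0\<^sub>v p))"

abbreviation t_irreducible :: "nat \<Rightarrow> nat \<Rightarrow> 'a::zero tmat \<Rightarrow> bool" where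
  "t_irreducible n p A \<equiv> \<not> t_reducible n p A"

abbreviation complex_tvec :: "real tvec \<Rightarrow> complex tvec" where
  "complex_tvec \<equiv> map_vec (map_vec complex_of_real)"

abbreviation complex_tmat :: "real tmat \<Rightarrow> complex tmat" where
  "complex_tmat \<equiv> map_mat (map_vec complex_of_real)"

definition t_eigenvector ::
  "nat \<Rightarrow> nat \<Rightarrow> real tmat \<Rightarrow> complex tvec \<Rightarrow> complex \<Rightarrow> bool" where
  "t_eigenvector n p A X l \<longleftrightarrow>
     X \<in> carrier_tvec n p \<and> X \<noteq> zero_tvec n p \<and>
     tmat_mult_tvec n p (complex_tmat A) X = smult_tvec l X"

definition t_eigenvalue :: "nat \<Rightarrow> nat \<Rightarrow> real tmat \<Rightarrow> complex \<Rightarrow> bool" where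
  "t_eigenvalue n p A l \<longleftrightarrow> (\<exists>X. t_eigenvector n p A X l)"

text \<open>
  For \<open>n, p \<ge> 1\<close> the set below is finite and nonempty, because \<open>X \<mapsto> A * X\<close> is a linear
  endomorphism of a complex space of dimension \<open>n p\<close>; so the maximum is attained.
\<close>

definition t_spectral_radius :: "nat \<Rightarrow> nat \<Rightarrow> real tmat \<Rightarrow> real" where
  "t_spectral_radius n p A = Max {cmod l | l. t_eigenvalue n p A l}"

end

theory Submission
  imports Defs "HOL-Analysis.Function_Topology" "Jordan_Normal_Form.Char_Poly"
begin

text \<open>
  Reading a tubal vector as a function on \<open>{..<n} \<times> {..<p}\<close> turns \<open>A\<close> into a block circulant
  matrix, which is irreducible as an ordinary matrix because of the strongly positive entry; this
  reduces the claim to the Perron-Frobenius theorem. The Perron eigenvector is obtained by the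
  Collatz-Wielandt argument: the largest \<open>r\<close> with \<open>r x \<le> B x\<close> for some \<open>x\<close> in the simplex is
  attained by compactness, and if \<open>r x \<noteq> B x\<close> then repeatedly replacing \<open>x\<close> by \<open>x + B x\<close> makes the
  inequality strict in every component, so that \<open>r\<close> could be increased.
\<close>

section \<open>Perron-Frobenius theory of irreducible nonnegative matrices\<close>

text \<open>Read \<open>0 < B s t\<close> as an edge from \<open>s\<close> to \<open>t\<close>.
  Irreducibility is phrased through sets without outgoing edges because zero sets of nonnegative
  vectors turn out to be such sets.\<close>

locale nonneg_irreducible =
  fixes S :: "'a set" and B :: "'a \<Rightarrow> 'a \<Rightarrow> real"
  assumes finite_S: "finite S"
    and nonempty_S: "S \<noteq> {}"
    and nonneg: "s \<in> S \<Longrightarrow> t \<in> S \<Longrightarrow> 0 \<le> B s t"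
    and irreducible:
      "Z \<subseteq> S \<Longrightarrow> Z \<noteq> {} \<Longrightarrow> (\<And>s t. s \<in> Z \<Longrightarrow> t \<in> S - Z \<Longrightarrow> B s t = 0) \<Longrightarrow> Z = S"
begin

definition mv :: "('a \<Rightarrow> real) \<Rightarrow> 'a \<Rightarrow> real" where
  "mv x s = (\<Sum>t\<in>S. B s t * x t)"

lemma mv_nonneg: "s \<in> S \<Longrightarrow> (\<And>t. t \<in> S \<Longrightarrow> 0 \<le> x t) \<Longrightarrow> 0 \<le> mv x s"
  unfolding mv_def by (intro sum_nonneg mult_nonneg_nonneg nonneg)

lemma mv_add: "mv (\<lambda>t. x t + y t) s = mv x s + mv y s"
  unfolding mv_def by (simp add: distrib_left sum.distrib)

lemma mv_diff: "mv (\<lambda>t. x t - y t) s = mv x s - mv y s"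
  unfolding mv_def by (simp add: right_diff_distrib sum_subtractf)

lemma mv_scale: "mv (\<lambda>t. c * x t) s = c * mv x s"
  unfolding mv_def by (simp add: sum_distrib_left mult_ac)

lemma mv_cong: "(\<And>t. t \<in> S \<Longrightarrow> x t = y t) \<Longrightarrow> mv x s = mv y s"
  unfolding mv_def by (intro sum.cong) auto

text \<open>All terms of \<open>mv x s\<close> are nonnegative, so if the sum is 0 at a zero of
  \<open>x\<close>, then \<open>B s t = 0\<close> wherever \<open>x t\<close> is positive: the zero
  set has no outgoing edge. Asking only that \<open>mv x\<close> vanishes at the zeros of
  \<open>x\<close> covers nonnegative eigenvectors as well as the defect \<open>y\<close> in the
  next proof.\<close>

lemma pos_if_zeros_preserved:
  assumes "\<And>s. s \<in> S \<Longrightarrow> 0 \<le> x s" and "\<exists>s\<in>S. x s \<noteq> 0"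
    and "\<And>s. s \<in> S \<Longrightarrow> x s = 0 \<Longrightarrow> mv x s = 0" and "s \<in> S"
  shows "0 < x s"
proof (rule ccontr)
  assume "\<not> 0 < x s"
  define Z where "Z = {s \<in> S. x s = 0}"
  have "Z = S"
  proof (rule irreducible)
    show "Z \<subseteq> S" "Z \<noteq> {}"
      using \<open>\<not> 0 < x s\<close> assms(1)[of s] \<open>s \<in> S\<close> by (force simp: Z_def)+
    fix u t assume u: "u \<in> Z" and t: "t \<in> S - Z"
    have "B u t * x t = 0"
      using assms(3)[of u] u t sum_nonneg_eq_0_iff[OF finite_S, of "\<lambda>t. B u t * x t"] nonneg assms(1)
      by (auto simp: Z_def mv_def)
    with t show "B u t = 0" by (auto simp: Z_def)
  qed
  with assms(2) show False by (auto simp: Z_def)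
qed

section \<open>Existence of a positive eigenvector\<close>

text \<open>Passing from \<open>x\<close> to x + Bx turns the defect y = Bx - rx into y + By, which
  is positive wherever y is. Hence the number of equalities drops, unless \<open>mv y\<close>
  vanishes at every zero of \<open>y\<close>; in that case \<open>y\<close> is positive on
  \<open>S\<close> and \<open>x\<close> itself is the witness.\<close>

lemma strict_subinvariant:
  assumes "\<And>s. s \<in> S \<Longrightarrow> 0 \<le> x s" and "\<And>s. s \<in> S \<Longrightarrow> r * x s \<le> mv x s"
    and "\<exists>s\<in>S. r * x s \<noteq> mv x s"
  shows "\<exists>x'. (\<forall>s\<in>S. 0 \<le> x' s) \<and> (\<forall>s\<in>S. r * x' s < mv x' s)"
  using assms
proof (induction "card {s \<in> S. r * x s = mv x s}" arbitrary: x rule: less_induct)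
  case less
  define y where "y = (\<lambda>s. mv x s - r * x s)"
  have y: "0 \<le> y s" if "s \<in> S" for s
    using less.prems(2)[OF that] by (simp add: y_def)
  show ?case
  proof (cases "\<forall>s\<in>S. y s = 0 \<longrightarrow> mv y s = 0")
    case True
    have "0 < y s" if "s \<in> S" for s
      using pos_if_zeros_preserved[of y s] y True less.prems(3) that by (force simp: y_def)
    with less.prems(1) show ?thesis by (intro exI[of _ x]) (auto simp: y_def)
  next
    case False
    define x' where "x' = (\<lambda>s. x s + mv x s)"
    have x'_eq: "mv x' s - r * x' s = y s + mv y s" for s
      by (simp add: x'_def y_def mv_add mv_diff mv_scale algebra_simps)
    have my: "0 \<le> mv y s" if "s \<in> S" for s
      using that y by (rule mv_nonneg)
    have sub: "{s \<in> S. r * x' s = mv x' s} \<subset> {s \<in> S. r * x s = mv x s}"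
    proof (rule psubsetI)
      have "y s = 0" if "s \<in> S" "r * x' s = mv x' s" for s
        using x'_eq[of s] that y[of s] my[of s] by linarith
      then show "{s \<in> S. r * x' s = mv x' s} \<subseteq> {s \<in> S. r * x s = mv x s}"
        by (auto simp: y_def)
      from False obtain s where "s \<in> S" "y s = 0" "mv y s \<noteq> 0" by blast
      then have "s \<in> {s \<in> S. r * x s = mv x s}" "s \<notin> {s \<in> S. r * x' s = mv x' s}"
        using x'_eq[of s] by (auto simp: y_def)
      then show "{s \<in> S. r * x' s = mv x' s} \<noteq> {s \<in> S. r * x s = mv x s}" by blast
    qed
    show ?thesis
    proof (rule less.hyps)
      show "card {s \<in> S. r * x' s = mv x' s} < card {s \<in> S. r * x s = mv x s}"
        using sub finite_S by (intro psubset_card_mono) auto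
      show "0 \<le> x' s" if "s \<in> S" for s
        using less.prems(1) mv_nonneg[of s x] that by (auto simp: x'_def)
      show "r * x' s \<le> mv x' s" if "s \<in> S" for s
        using x'_eq[of s] y[OF that] my[OF that] by linarith
      obtain s where s: "s \<in> S" "mv y s \<noteq> 0" using False by blast
      then show "\<exists>s\<in>S. r * x' s \<noteq> mv x' s"
        using x'_eq[of s] y[of s] my[of s] by (intro bexI[of _ s]) auto
    qed
  qed
qed

text \<open>These are the Collatz-Wielandt pairs. Keeping \<open>r\<close> in the pair makes the
  optimal value a maximum of \<open>fst\<close>. Values outside \<open>S\<close> are fixed to 0
  because compactness is taken in the space of functions on the whole type.\<close>

definition subinvariant :: "(real \<times> ('a \<Rightarrow> real)) set" where
  "subinvariant = {(r, x). 0 \<le> r \<and> (\<forall>s. 0 \<le> x s) \<and> (\<forall>s. s \<notin> S \<longrightarrow> x s = 0) \<and>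
     sum x S = 1 \<and> (\<forall>s\<in>S. r * x s \<le> mv x s)}"

lemma subinvariant_le_1:
  assumes "(r, x) \<in> subinvariant"
  shows "x s \<le> 1"
proof (cases "s \<in> S")
  case True
  then have "x s \<le> sum x S"
    using assms finite_S by (intro member_le_sum) (auto simp: subinvariant_def)
  then show ?thesis using assms by (simp add: subinvariant_def)
qed (use assms in \<open>auto simp: subinvariant_def\<close>)

text \<open>Summing the inequalities over \<open>S\<close> leaves \<open>r\<close> on the left,
  since the entries of \<open>x\<close> sum to 1; on the right each entry is at most 1.\<close>

lemma subinvariant_bound:
  assumes "(r, x) \<in> subinvariant"
  shows "r \<le> (\<Sum>s\<in>S. \<Sum>t\<in>S. B s t)"
proof -
  have "r = (\<Sum>s\<in>S. r * x s)"
    using assms by (simp add: subinvariant_def flip: sum_distrib_left)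
  also have "\<dots> \<le> (\<Sum>s\<in>S. mv x s)"
    using assms by (intro sum_mono) (auto simp: subinvariant_def)
  also have "\<dots> \<le> (\<Sum>s\<in>S. \<Sum>t\<in>S. B s t)"
    unfolding mv_def using nonneg subinvariant_le_1[OF assms]
    by (intro sum_mono) (auto intro!: mult_left_le)
  finally show ?thesis .
qed

text \<open>The set is closed and lies in a product of compact intervals. The index type may be
  infinite, so compactness of the box \<open>K\<close> is an instance of Tychonoff's
  theorem.\<close>

lemma compact_subinvariant: "compact subinvariant"
proof -
  define M where "M = (\<Sum>s\<in>S. \<Sum>t\<in>S. B s t)"
  define K where "K = PiE (UNIV :: 'a set) (\<lambda>_. {0..1::real})"
  have "compactin (product_topology (\<lambda>_::'a. euclidean :: real topology) UNIV) K"
    unfolding K_def compactin_PiE by auto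
  then have "compact K"
    by (simp add: euclidean_product_topology)
  then have K: "compact ({0..M} \<times> K)"
    by (intro compact_Times compact_Icc)
  have coord: "continuous_on UNIV (\<lambda>q::real \<times> ('a \<Rightarrow> real). snd q s)" for s
    by (rule continuous_on_compose2[OF continuous_on_product_coordinates[of s]])
       (auto intro: continuous_intros)
  \<comment> \<open>Written with \<open>fst\<close> and \<open>snd\<close>, every condition is an
    equation or inequality between continuous functions of \<open>q\<close>.\<close>
  have "closed {q::real \<times> ('a \<Rightarrow> real). 0 \<le> fst q \<and> (\<forall>s. 0 \<le> snd q s) \<and>
      (\<forall>s. s \<notin> S \<longrightarrow> snd q s = 0) \<and> (\<Sum>s\<in>S. snd q s) = 1 \<and>
      (\<forall>s. s \<in> S \<longrightarrow> fst q * snd q s \<le> (\<Sum>t\<in>S. B s t * snd q t))}"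
    by (intro closed_Collect_conj closed_Collect_all closed_Collect_imp closed_Collect_le
          closed_Collect_eq open_Collect_const continuous_intros coord)
  also have "\<dots> = subinvariant"
    by (auto simp: subinvariant_def mv_def)
  finally have "compact (({0..M} \<times> K) \<inter> subinvariant)"
    using K by (rule compact_Int_closed[rotated])
  moreover have "subinvariant \<subseteq> {0..M} \<times> K"
  proof
    fix q assume q: "q \<in> subinvariant"
    then obtain r x where rx: "q = (r, x)" "(r, x) \<in> subinvariant" by (cases q) auto
    then show "q \<in> {0..M} \<times> K"
      using subinvariant_le_1[OF rx(2)] subinvariant_bound[OF rx(2)]
      by (simp add: subinvariant_def K_def M_def PiE_UNIV_domain)
  qed
  ultimately show ?thesis by (simp add: Int_absorb1)
qed

theorem ex_pos_eigenvector:
  "\<exists>r x. 0 \<le> r \<and> (\<forall>s\<in>S. 0 < x s) \<and> (\<forall>s\<in>S. mv x s = r * x s)"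
proof -
  obtain s0 where s0: "s0 \<in> S" using nonempty_S by blast
  \<comment> \<open>The indicator of \<open>s0\<close> shows that the compact set is
    nonempty.\<close>
  have "(0, \<lambda>s. if s = s0 then 1 else 0) \<in> subinvariant"
    using s0 finite_S mv_nonneg by (auto simp: subinvariant_def)
  then obtain r x where rx: "(r, x) \<in> subinvariant"
    and max: "\<And>r' x'. (r', x') \<in> subinvariant \<Longrightarrow> r' \<le> r"
    using continuous_attains_sup[OF compact_subinvariant, of fst] continuous_on_fst[OF continuous_on_id]
    by fastforce
  have x: "\<And>s. 0 \<le> x s" "sum x S = 1" "\<And>s. s \<in> S \<Longrightarrow> r * x s \<le> mv x s" "0 \<le> r"
    using rx by (auto simp: subinvariant_def)
  have eig: "\<forall>s\<in>S. mv x s = r * x s"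
  proof (rule ccontr)
    \<comment> \<open>As \<open>S\<close> is finite, the strict inequalities for \<open>y\<close>
      survive a small increase of \<open>r\<close> to \<open>r'\<close>; normalising
      \<open>y\<close> then contradicts the maximality of \<open>r\<close>.\<close>
    assume "\<not> ?thesis"
    then obtain y where y: "\<And>s. s \<in> S \<Longrightarrow> 0 \<le> y s" "\<And>s. s \<in> S \<Longrightarrow> r * y s < mv y s"
      using strict_subinvariant[of x r] x by metis
    have "\<forall>\<^sub>F r' in at_right r. \<forall>s\<in>S. r' * y s < mv y s"
      using finite_S
    proof (rule eventually_ball_finite, intro ballI)
      fix s assume "s \<in> S"
      have "((\<lambda>r'. r' * y s) \<longlongrightarrow> r * y s) (at_right r)" by (intro tendsto_intros)
      then show "\<forall>\<^sub>F r' in at_right r. r' * y s < mv y s"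
        using y(2)[OF \<open>s \<in> S\<close>] by (rule order_tendstoD)
    qed
    moreover have "\<forall>\<^sub>F r' in at_right r. r < r'" by (rule eventually_at_right_less)
    ultimately have "\<forall>\<^sub>F r' in at_right r. r < r' \<and> (\<forall>s\<in>S. r' * y s < mv y s)"
      by eventually_elim blast
    then have "\<exists>r'. r < r' \<and> (\<forall>s\<in>S. r' * y s < mv y s)"
      by (rule eventually_happens'[OF trivial_limit_at_right_real])
    then obtain r' where r': "r < r'" "\<And>s. s \<in> S \<Longrightarrow> r' * y s < mv y s" by blast
    \<comment> \<open>If \<open>y\<close> vanished on \<open>S\<close>, the strict inequality at
      \<open>s0\<close> would read 0 < 0.\<close>
    have "sum y S \<noteq> 0"
    proof
      assume "sum y S = 0"
      then have y0: "\<And>t. t \<in> S \<Longrightarrow> y t = 0"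
        using y(1) finite_S by (simp add: sum_nonneg_eq_0_iff)
      then have "mv y s0 = 0" by (simp add: mv_def)
      with y(2)[OF s0] y0[OF s0] show False by simp
    qed
    then have c: "0 < sum y S" using y(1) by (simp add: sum_nonneg order_less_le)
    define z where "z = (\<lambda>s. if s \<in> S then inverse (sum y S) * y s else 0)"
    have "mv z s = inverse (sum y S) * mv y s" for s
      using mv_cong[of z "\<lambda>t. inverse (sum y S) * y t" s] by (simp add: z_def mv_scale)
    moreover have "sum z S = inverse (sum y S) * sum y S"
      unfolding sum_distrib_left by (rule sum.cong) (simp_all add: z_def)
    ultimately have "(r', z) \<in> subinvariant"
      using c y(1) r' \<open>0 \<le> r\<close> less_imp_le[OF r'(2)]
      by (auto simp: subinvariant_def z_def divide_simps mult.commute)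
    with max[of r' z] r'(1) show False by simp
  qed
  have "0 < x s" if "s \<in> S" for s
  proof (rule pos_if_zeros_preserved[OF x(1) _ _ that])
    show "\<exists>s\<in>S. x s \<noteq> 0" using x(2) by (metis sum.neutral zero_neq_one)
  qed (use eig in auto)
  with eig x(4) show ?thesis by blast
qed

section \<open>Comparison with a positive eigenvector: dominance and uniqueness\<close>

text \<open>The ratio \<open>\<bar>v s\<bar> / x s\<close> is compared at an index where it is maximal.\<close>

lemma eigenvalue_le:
  fixes v :: "'a \<Rightarrow> complex"
  assumes x: "\<And>s. s \<in> S \<Longrightarrow> 0 < x s" "\<And>s. s \<in> S \<Longrightarrow> mv x s = r * x s"
    and v: "\<exists>s\<in>S. v s \<noteq> 0" "\<And>s. s \<in> S \<Longrightarrow> (\<Sum>t\<in>S. of_real (B s t) * v t) = l * v s"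
  shows "cmod l \<le> r"
proof -
  obtain s where s: "s \<in> S" and max: "\<And>t. t \<in> S \<Longrightarrow> cmod (v t) / x t \<le> cmod (v s) / x s"
  proof -
    have "Max ((\<lambda>t. cmod (v t) / x t) ` S) \<in> (\<lambda>t. cmod (v t) / x t) ` S"
      using finite_S nonempty_S by (intro Max_in) auto
    then obtain s where s: "s \<in> S" "cmod (v s) / x s = Max ((\<lambda>t. cmod (v t) / x t) ` S)"
      unfolding image_iff by metis
    show thesis
    proof (rule that[OF s(1)], unfold s(2))
    qed (use finite_S in \<open>auto intro: Max_ge\<close>)
  qed
  define m where "m = cmod (v s) / x s"
  have m: "cmod (v t) \<le> m * x t" if "t \<in> S" for t
    using max[OF that] x(1)[OF that] by (simp add: m_def pos_divide_le_eq)
  have vs: "cmod (v s) = m * x s" using x(1)[OF s] by (simp add: m_def)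
  obtain t where t: "t \<in> S" "v t \<noteq> 0" using v(1) by blast
  \<comment> \<open>Positivity of \<open>m\<close> allows the factor \<open>m * x s\<close> to be
    cancelled in the final inequality.\<close>
  have "0 < m * x t" using m[OF t(1)] t(2) by (smt (verit) zero_less_norm_iff)
  then have "0 < m" using x(1)[OF t(1)] by (simp add: zero_less_mult_iff)
  have "cmod l * (m * x s) = cmod (\<Sum>t\<in>S. of_real (B s t) * v t)"
    using v(2)[OF s] by (simp add: norm_mult vs)
  also have "\<dots> \<le> (\<Sum>t\<in>S. B s t * cmod (v t))"
    using nonneg[OF s] by (intro sum_norm_le) (simp add: norm_mult)
  also have "\<dots> \<le> mv (\<lambda>t. m * x t) s"
    unfolding mv_def using nonneg[OF s] m by (intro sum_mono mult_left_mono)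
  also have "\<dots> = r * (m * x s)"
    using x(2)[OF s] by (simp add: mv_scale)
  finally show ?thesis using \<open>0 < m\<close> x(1)[OF s] by simp
qed

text \<open>The eigenvalue of a positive eigenvector bounds the modulus of every eigenvalue;
  applying this in both directions gives equality.\<close>

lemma pos_eigenvectors_same_eigenvalue:
  assumes x: "\<And>s. s \<in> S \<Longrightarrow> 0 < x s" "\<And>s. s \<in> S \<Longrightarrow> mv x s = r * x s"
    and y: "\<And>s. s \<in> S \<Longrightarrow> 0 < y s" "\<And>s. s \<in> S \<Longrightarrow> mv y s = q * y s"
  shows "q = r"
proof -
  have le: "b \<le> a" if w: "\<And>s. s \<in> S \<Longrightarrow> 0 < w s" "\<And>s. s \<in> S \<Longrightarrow> mv w s = a * w s"
    and z: "\<And>s. s \<in> S \<Longrightarrow> 0 < z s" "\<And>s. s \<in> S \<Longrightarrow> mv z s = b * z s" for a b w z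
  proof -
    have "cmod (of_real b) \<le> a"
    proof (rule eigenvalue_le[OF w])
      show "\<exists>s\<in>S. complex_of_real (z s) \<noteq> 0" using z(1) nonempty_S by fastforce
      show "(\<Sum>t\<in>S. of_real (B s t) * complex_of_real (z t)) = of_real b * of_real (z s)"
        if "s \<in> S" for s
        using arg_cong[OF z(2)[OF that], of complex_of_real] by (simp add: mv_def)
    qed auto
    then show ?thesis by simp
  qed
  show ?thesis using le[OF x y] le[OF y x] by simp
qed

text \<open>Subtract from \<open>y\<close> the largest multiple of \<open>x\<close> that keeps the
  difference \<open>z\<close> nonnegative. Then \<open>z\<close> satisfies the eigenvector equation
  and has a zero, so it vanishes on \<open>S\<close>, since otherwise it would be positive
  everywhere on \<open>S\<close>. No sign condition on \<open>y\<close> is required.\<close>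

lemma pos_eigenvector_unique:
  assumes x: "\<And>s. s \<in> S \<Longrightarrow> 0 < x s" "\<And>s. s \<in> S \<Longrightarrow> mv x s = r * x s"
    and y: "\<And>s. s \<in> S \<Longrightarrow> mv y s = r * y s"
  shows "\<exists>c. \<forall>s\<in>S. y s = c * x s"
proof -
  obtain s where s: "s \<in> S" and min: "\<And>t. t \<in> S \<Longrightarrow> y s / x s \<le> y t / x t"
  proof -
    have "Min ((\<lambda>t. y t / x t) ` S) \<in> (\<lambda>t. y t / x t) ` S"
      using finite_S nonempty_S by (intro Min_in) auto
    then obtain s where s: "s \<in> S" "y s / x s = Min ((\<lambda>t. y t / x t) ` S)"
      unfolding image_iff by metis
    show thesis
    proof (rule that[OF s(1)], unfold s(2))
    qed (use finite_S in \<open>auto intro: Min_le\<close>)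
  qed
  define z where "z = (\<lambda>t. y t - y s / x s * x t)"
  have z: "0 \<le> z t" if "t \<in> S" for t
    using min[OF that] x(1)[OF that] by (simp add: z_def pos_le_divide_eq)
  have mz: "mv z t = r * z t" if "t \<in> S" for t
    using x(2)[OF that] y[OF that] unfolding z_def mv_diff mv_scale by (simp add: algebra_simps)
  have "z s = 0" using x(1)[OF s] by (simp add: z_def)
  then have "\<forall>t\<in>S. z t = 0"
    using pos_if_zeros_preserved[of z s] z mz s by fastforce
  then show ?thesis by (intro exI[of _ "y s / x s"]) (simp add: z_def)
qed

end

section \<open>Finiteness of the spectrum\<close>

text \<open>An enumeration of \<open>S\<close> turns \<open>B\<close> into a square matrix, whose
  eigenvalues are roots of a monic polynomial. Finiteness is what makes the \<open>Max\<close> in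
  the spectral radius meaningful.\<close>

lemma finite_eigenvalues:
  fixes B :: "'a \<Rightarrow> 'a \<Rightarrow> 'b::field"
  assumes "finite S"
  shows "finite {l. \<exists>v. (\<exists>s\<in>S. v s \<noteq> 0) \<and> (\<forall>s\<in>S. (\<Sum>t\<in>S. B s t * v t) = l * v s)}"
proof -
  define N where "N = card S"
  obtain f where f: "bij_betw f {0..<N} S"
    using ex_bij_betw_nat_finite[OF assms] N_def by blast
  define M where "M = mat N N (\<lambda>(a, b). B (f a) (f b))"
  have M: "M \<in> carrier_mat N N" by (simp add: M_def)
  have "eigenvalue M l"
    if v: "\<exists>s\<in>S. v s \<noteq> 0" "\<forall>s\<in>S. (\<Sum>t\<in>S. B s t * v t) = l * v s" for l v
  proof -
    have "eigenvector M (vec N (v \<circ> f)) l"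
      unfolding eigenvector_def
    proof (intro conjI)
      show "vec N (v \<circ> f) \<noteq> 0\<^sub>v (dim_row M)"
      proof
        assume "vec N (v \<circ> f) = 0\<^sub>v (dim_row M)"
        then have "\<forall>a<N. v (f a) = 0"
          using M by (metis carrier_matD(1) comp_apply index_vec index_zero_vec(1))
        with v(1) f show False by (auto simp: bij_betw_def)
      qed
      show "M *\<^sub>v vec N (v \<circ> f) = l \<cdot>\<^sub>v vec N (v \<circ> f)"
      proof (rule eq_vecI)
        fix a assume a: "a < dim_vec (l \<cdot>\<^sub>v vec N (v \<circ> f))"
        then have "f a \<in> S" using f by (auto simp: bij_betw_def)
        have "(M *\<^sub>v vec N (v \<circ> f)) $ a = (\<Sum>b\<in>{0..<N}. B (f a) (f b) * v (f b))"
          using a by (simp add: M_def scalar_prod_def)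
        also have "\<dots> = (\<Sum>t\<in>S. B (f a) t * v t)"
          by (rule sum.reindex_bij_betw[OF f])
        finally show "(M *\<^sub>v vec N (v \<circ> f)) $ a = (l \<cdot>\<^sub>v vec N (v \<circ> f)) $ a"
          using v(2) \<open>f a \<in> S\<close> a by simp
      qed (simp add: M_def)
    qed (simp add: M_def)
    then show ?thesis unfolding eigenvalue_def by blast
  qed
  then have "{l. \<exists>v. (\<exists>s\<in>S. v s \<noteq> 0) \<and> (\<forall>s\<in>S. (\<Sum>t\<in>S. B s t * v t) = l * v s)}
      \<subseteq> {l. poly (char_poly M) l = 0}"
    using eigenvalue_root_char_poly[OF M] by auto
  moreover have "char_poly M \<noteq> 0" using degree_monic_char_poly[OF M] by auto
  ultimately show ?thesis by (rule finite_subset[OF _ poly_roots_finite])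
qed

section \<open>Tubal vectors as functions on index pairs\<close>

definition flat :: "'a tvec \<Rightarrow> nat \<times> nat \<Rightarrow> 'a" where
  "flat X = (\<lambda>(i, k). X $ i $ k)"

definition unflat :: "nat \<Rightarrow> nat \<Rightarrow> (nat \<times> nat \<Rightarrow> 'a) \<Rightarrow> 'a tvec" where
  "unflat n p x = vec n (\<lambda>i. vec p (\<lambda>k. x (i, k)))"

text \<open>Multiplication by a tubal scalar is a circulant matrix; \<open>(k + p - l) mod p\<close> is \<open>k - l\<close>
  modulo \<open>p\<close> without truncation, since \<open>l < p\<close>.\<close>

definition bcirc :: "nat \<Rightarrow> 'a tmat \<Rightarrow> nat \<times> nat \<Rightarrow> nat \<times> nat \<Rightarrow> 'a" where
  "bcirc p A = (\<lambda>(i, k) (j, l). A $$ (i, j) $ ((k + p - l) mod p))"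

lemma flat_unflat: "s \<in> {..<n} \<times> {..<p} \<Longrightarrow> flat (unflat n p x) s = x s"
  by (auto simp: flat_def unflat_def)

lemma tvec_eq_iff:
  assumes "X \<in> carrier_tvec n p" "Y \<in> carrier_tvec n p"
  shows "X = Y \<longleftrightarrow> (\<forall>s\<in>{..<n} \<times> {..<p}. flat X s = flat Y s)"
proof
  assume eq: "\<forall>s\<in>{..<n} \<times> {..<p}. flat X s = flat Y s"
  show "X = Y"
  proof (rule eq_vecI)
    fix i assume "i < dim_vec Y"
    then have i: "i < n" using assms by (auto simp: carrier_tvec_def)
    then have "X $ i \<in> carrier_vec p" "Y $ i \<in> carrier_vec p"
      using assms by (auto simp: carrier_tvec_def)
    moreover have "X $ i $ k = Y $ i $ k" if "k < p" for k
      using eq i that by (force simp: flat_def)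
    ultimately show "X $ i = Y $ i" by (intro eq_vecI) auto
  qed (use assms in \<open>auto simp: carrier_tvec_def\<close>)
qed simp

lemma zero_tvec_carrier [simp]: "zero_tvec n p \<in> carrier_tvec n p"
  by (simp add: zero_tvec_def carrier_tvec_def)

lemma smult_tvec_carrier: "X \<in> carrier_tvec n p \<Longrightarrow> smult_tvec c X \<in> carrier_tvec n p"
  by (auto simp: smult_tvec_def carrier_tvec_def)

lemma tmat_mult_tvec_carrier [simp]: "tmat_mult_tvec n p A X \<in> carrier_tvec n p"
  by (simp add: tmat_mult_tvec_def carrier_tvec_def)

lemma unflat_carrier [simp]: "unflat n p x \<in> carrier_tvec n p"
  by (simp add: unflat_def carrier_tvec_def)

lemma complex_tvec_carrier: "X \<in> carrier_tvec n p \<Longrightarrow> complex_tvec X \<in> carrier_tvec n p"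
  by (auto simp: carrier_tvec_def)

lemma flat_zero_tvec: "s \<in> {..<n} \<times> {..<p} \<Longrightarrow> flat (zero_tvec n p) s = 0"
  by (auto simp: flat_def zero_tvec_def)

lemma flat_smult_tvec:
  "X \<in> carrier_tvec n p \<Longrightarrow> s \<in> {..<n} \<times> {..<p} \<Longrightarrow> flat (smult_tvec c X) s = c * flat X s"
  by (auto simp: flat_def smult_tvec_def carrier_tvec_def)

lemma flat_complex_tvec:
  "X \<in> carrier_tvec n p \<Longrightarrow> s \<in> {..<n} \<times> {..<p} \<Longrightarrow>
   flat (complex_tvec X) s = complex_of_real (flat X s)"
  by (auto simp: flat_def carrier_tvec_def)

text \<open>For given \<open>b\<close> and \<open>k\<close>, exactly one residue \<open>a\<close>
  satisfies a + b = k modulo \<open>p\<close>, and \<open>(k + p - b) mod p\<close> is its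
  representative below \<open>p\<close>.\<close>

lemma mod_diff_eqs:
  fixes b k p :: nat
  assumes "b < p" "k < p"
  shows "((k + p - b) mod p + b) mod p = k" "a < p \<Longrightarrow> (a + b) mod p = k \<Longrightarrow> (k + p - b) mod p = a"
proof -
  show "((k + p - b) mod p + b) mod p = k"
    using assms by (simp add: mod_add_left_eq)
  assume a: "a < p" "(a + b) mod p = k"
  show "(k + p - b) mod p = a"
  \<comment> \<open>Without wraparound \<open>k + p - b\<close> is a + p, which reduces to
    \<open>a\<close>; with wraparound it is already \<open>a\<close>.\<close>
  proof (cases "a + b < p")
    case True
    then show ?thesis using a assms by auto
  next
    case False
    then have "k = a + b - p" using a assms by (auto simp: mod_if split: if_splits)
    then show ?thesis using False a assms by simp
  qed
qed

text \<open>In the convolution sum the first index is determined by the second, so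
  \<open>snd\<close> reindexes the pairs by a single residue. The product thereby becomes an
  ordinary matrix-vector product.\<close>

lemma flat_tmat_mult_tvec:
  assumes "s \<in> {..<n} \<times> {..<p}"
  shows "flat (tmat_mult_tvec n p A X) s = (\<Sum>t\<in>{..<n} \<times> {..<p}. bcirc p A s t * flat X t)"
proof -
  obtain i k where s: "s = (i, k)" "i < n" "k < p" using assms by auto
  have "tscalar_mult p (A $$ (i, j)) (X $ j) $ k = (\<Sum>l<p. bcirc p A s (j, l) * flat X (j, l))" for j
  proof -
    have "(\<Sum>(a, b)\<in>{(a, b). a < p \<and> b < p \<and> (a + b) mod p = k}. A $$ (i, j) $ a * X $ j $ b) =
        (\<Sum>b<p. A $$ (i, j) $ ((k + p - b) mod p) * X $ j $ b)"
      by (rule sum.reindex_bij_witness[of _ "\<lambda>b. ((k + p - b) mod p, b)" snd])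
         (use s in \<open>auto simp: mod_diff_eqs\<close>)
    then show ?thesis using s by (simp add: tscalar_mult_def bcirc_def flat_def)
  qed
  then show ?thesis
    using s by (simp add: flat_def tmat_mult_tvec_def sum.cartesian_product split_beta)
qed

lemma bcirc_complex_tmat:
  assumes "A \<in> nonneg_tmats n p" "s \<in> {..<n} \<times> {..<p}" "t \<in> {..<n} \<times> {..<p}"
  shows "bcirc p (complex_tmat A) s t = complex_of_real (bcirc p A s t)"
proof -
  obtain i k j l where st: "s = (i, k)" "t = (j, l)" "i < n" "k < p" "j < n" "l < p"
    using assms(2,3) by auto
  moreover have "A $$ (i, j) \<in> carrier_vec p"
    using assms(1) st by (auto simp: nonneg_tmats_def nonneg_tscalars_def)
  ultimately show ?thesis
    using assms(1) by (auto simp: bcirc_def nonneg_tmats_def)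
qed

lemma t_eigenvector_iff:
  assumes "A \<in> nonneg_tmats n p" "X \<in> carrier_tvec n p"
  shows "t_eigenvector n p A X l \<longleftrightarrow>
    (\<exists>s\<in>{..<n} \<times> {..<p}. flat X s \<noteq> 0) \<and>
    (\<forall>s\<in>{..<n} \<times> {..<p}.
      (\<Sum>t\<in>{..<n} \<times> {..<p}. complex_of_real (bcirc p A s t) * flat X t) = l * flat X s)"
  using assms
  by (simp add: t_eigenvector_def tvec_eq_iff[of _ n p] smult_tvec_carrier flat_zero_tvec
      flat_smult_tvec flat_tmat_mult_tvec bcirc_complex_tmat cong: sum.cong)

text \<open>Only the values of \<open>v\<close> on the index pairs matter, so \<open>unflat\<close>
  converts any such function back into a tubal eigenvector.\<close>

lemma t_eigenvalue_iff:
  assumes "A \<in> nonneg_tmats n p"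
  shows "t_eigenvalue n p A l \<longleftrightarrow>
    (\<exists>v. (\<exists>s\<in>{..<n} \<times> {..<p}. v s \<noteq> 0) \<and>
      (\<forall>s\<in>{..<n} \<times> {..<p}.
        (\<Sum>t\<in>{..<n} \<times> {..<p}. complex_of_real (bcirc p A s t) * v t) = l * v s))"
    (is "_ \<longleftrightarrow> (\<exists>v. ?E v)")
proof
  assume "t_eigenvalue n p A l"
  then obtain X where X: "t_eigenvector n p A X l" by (auto simp: t_eigenvalue_def)
  then have "X \<in> carrier_tvec n p" by (simp add: t_eigenvector_def)
  with X assms have "?E (flat X)" by (simp add: t_eigenvector_iff)
  then show "\<exists>v. ?E v" by blast
next
  assume "\<exists>v. ?E v"
  then obtain v where "?E v" by blast
  then have "t_eigenvector n p A (unflat n p v) l"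
    unfolding t_eigenvector_iff[OF assms unflat_carrier] by (simp add: flat_unflat cong: sum.cong)
  then show "t_eigenvalue n p A l" by (auto simp: t_eigenvalue_def)
qed

section \<open>Positivity and irreducibility of the block circulant matrix\<close>

lemma nonneg_tvecs_iff:
  "X \<in> nonneg_tvecs n p \<longleftrightarrow> X \<in> carrier_tvec n p \<and> (\<forall>s\<in>{..<n} \<times> {..<p}. 0 \<le> flat X s)"
  by (auto simp: nonneg_tvecs_def nonneg_tscalars_def carrier_tvec_def flat_def)

lemma strongly_pos_tvecs_iff:
  "X \<in> strongly_pos_tvecs n p \<longleftrightarrow> X \<in> carrier_tvec n p \<and> (\<forall>s\<in>{..<n} \<times> {..<p}. 0 < flat X s)"
  by (auto simp: strongly_pos_tvecs_def strongly_pos_tscalars_def carrier_tvec_def flat_def)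

lemma bcirc_nonneg:
  assumes "A \<in> nonneg_tmats n p" "s \<in> {..<n} \<times> {..<p}" "t \<in> {..<n} \<times> {..<p}"
  shows "0 \<le> bcirc p A s t"
  using assms by (auto simp: bcirc_def nonneg_tmats_def nonneg_tscalars_def)

text \<open>A nonzero nonnegative tubal scalar has a positive entry; its position \<open>m\<close>
  is the shift between copies of \<open>i\<close> and \<open>j\<close> joined by an edge.\<close>

lemma t_irreducible_edge:
  assumes "A \<in> nonneg_tmats n p" "t_irreducible n p A" "I \<noteq> {}" "I \<subset> {..<n}"
  shows "\<exists>i\<in>I. \<exists>j\<in>{..<n} - I. \<exists>m<p. 0 < A $$ (i, j) $ m"
proof -
  obtain i j where ij: "i \<in> I" "j \<in> {..<n} - I" "A $$ (i, j) \<noteq> 0\<^sub>v p"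
    using assms(2-4) unfolding t_reducible_def by blast
  then have A: "A $$ (i, j) \<in> carrier_vec p" "\<forall>m<p. 0 \<le> A $$ (i, j) $ m"
    using assms(1,4) by (auto simp: nonneg_tmats_def nonneg_tscalars_def)
  have "\<exists>m<p. A $$ (i, j) $ m \<noteq> 0"
    using ij(3) A(1) by (auto simp: vec_eq_iff)
  with A(2) have "\<exists>m<p. 0 < A $$ (i, j) $ m" by (metis order_le_less)
  with ij show ?thesis by blast
qed

text \<open>All \<open>p\<close> copies of \<open>i\<^sub>0\<close> are joined to all \<open>p\<close> copies of \<open>j\<^sub>0\<close>. A closed set \<open>Z\<close> therefore
  misses every copy of \<open>i\<^sub>0\<close> or contains every copy of \<open>j\<^sub>0\<close>; the indices with some copy in \<open>Z\<close>,
  respectively with all copies in \<open>Z\<close>, then form a reducing set of \<open>A\<close>.\<close>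

lemma bcirc_irreducible:
  assumes A: "A \<in> nonneg_tmats n p" and irr: "t_irreducible n p A"
    and pos: "i0 < n" "j0 < n" "A $$ (i0, j0) \<in> strongly_pos_tscalars p"
    and Z: "Z \<subseteq> {..<n} \<times> {..<p}" "Z \<noteq> {}"
    and closed: "\<And>s t. s \<in> Z \<Longrightarrow> t \<in> {..<n} \<times> {..<p} - Z \<Longrightarrow> bcirc p A s t = 0"
  shows "Z = {..<n} \<times> {..<p}"
proof (rule ccontr)
  assume neq: "Z \<noteq> {..<n} \<times> {..<p}"
  show False
  proof (cases "\<exists>k. (i0, k) \<in> Z")
    case False
    define I where "I = fst ` Z"
    have I: "I \<noteq> {}" using Z(2) by (simp add: I_def)
    have I': "I \<subset> {..<n}"
    proof
      show "I \<subseteq> {..<n}" using Z(1) by (auto simp: I_def)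
      have "i0 \<notin> I" using False by (auto simp: I_def)
      then show "I \<noteq> {..<n}" using pos(1) by blast
    qed
    obtain i j m where ij: "i \<in> I" "j \<in> {..<n} - I" "m < p" "0 < A $$ (i, j) $ m"
      using t_irreducible_edge[OF A irr I I'] by blast
    then obtain k where k: "(i, k) \<in> Z" "k < p" using Z(1) by (auto simp: I_def)
    \<comment> \<open>The copy \<open>l\<close> of \<open>j\<close> is chosen so that row
      \<open>(i, k)\<close> and column \<open>(j, l)\<close> meet in entry \<open>m\<close>; no copy
      of \<open>j\<close> lies in \<open>Z\<close>.\<close>
    define l where "l = (k + p - m) mod p"
    have "l < p" "(m + l) mod p = k"
      using mod_diff_eqs(1)[of m p k] k ij(3) by (simp_all add: l_def add.commute)
    then have "(k + p - l) mod p = m"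
      using mod_diff_eqs(2)[of l p k m] k ij(3) by simp
    then have "0 < bcirc p A (i, k) (j, l)" using ij(4) by (simp add: bcirc_def)
    moreover have "(j, l) \<notin> Z" using ij(2) by (force simp: I_def)
    ultimately show False using closed[OF k(1), of "(j, l)"] ij(2) \<open>l < p\<close> by simp
  next
    case True
    then obtain k0 where k0: "(i0, k0) \<in> Z" by blast
    define I where "I = {i. i < n \<and> (\<forall>k<p. (i, k) \<in> Z)}"
    have "(j0, l) \<in> Z" if "l < p" for l
    proof (rule ccontr)
      assume "(j0, l) \<notin> Z"
      then have "bcirc p A (i0, k0) (j0, l) = 0" using closed[OF k0, of "(j0, l)"] that pos(2) by simp
      moreover have "(k0 + p - l) mod p < p" using that by simp
      ultimately show False using pos(3) by (force simp: bcirc_def strongly_pos_tscalars_def)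
    qed
    then have "j0 \<in> I" using pos(2) by (simp add: I_def)
    then have I: "I \<noteq> {}" by blast
    have I': "I \<subset> {..<n}"
    proof -
      obtain i k where "i < n" "k < p" "(i, k) \<notin> Z" using neq Z(1) by auto
      then show ?thesis by (auto simp: I_def)
    qed
    obtain i j m where ij: "i \<in> I" "j \<in> {..<n} - I" "m < p" "0 < A $$ (i, j) $ m"
      using t_irreducible_edge[OF A irr I I'] by blast
    then obtain l where l: "l < p" "(j, l) \<notin> Z" "j < n" by (auto simp: I_def)
    \<comment> \<open>Now the copy \<open>l\<close> of \<open>j\<close> missing from
      \<open>Z\<close> is given and the copy of \<open>i\<close> is solved for, which is harmless as
      all copies of \<open>i\<close> lie in \<open>Z\<close>.\<close>
    define k where "k = (m + l) mod p"
    have "k < p" using l by (simp add: k_def)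
    have "(k + p - l) mod p = m"
      by (rule mod_diff_eqs(2)[OF l(1) \<open>k < p\<close> ij(3) k_def[symmetric]])
    then have "0 < bcirc p A (i, k) (j, l)" using ij(4) by (simp add: bcirc_def)
    moreover have "(i, k) \<in> Z" using ij(1) \<open>k < p\<close> by (simp add: I_def)
    ultimately show False using closed[of "(i, k)" "(j, l)"] l by simp
  qed
qed

section \<open>Transfer of the Perron-Frobenius statements to t-eigenvalues\<close>

theorem theorem4p4:
  fixes n p :: nat and A :: "real tmat"
  assumes "n \<ge> 1" and "p \<ge> 1"
    and "A \<in> nonneg_tmats n p"
    and "t_irreducible n p A"
    and "\<exists>i<n. \<exists>j<n. A $$ (i, j) \<in> strongly_pos_tscalars p"
  shows "(0 < t_spectral_radius n p A \<and>
            t_eigenvalue n p A (complex_of_real (t_spectral_radius n p A))) \<and>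
         (\<forall>l. \<forall>X \<in> nonneg_tvecs n p. X \<noteq> zero_tvec n p \<and> t_eigenvector n p A (complex_tvec X) l
            \<longrightarrow> X \<in> strongly_pos_tvecs n p) \<and>
         (\<exists>X \<in> strongly_pos_tvecs n p.
            t_eigenvector n p A (complex_tvec X) (complex_of_real (t_spectral_radius n p A)) \<and>
            (\<forall>Y \<in> strongly_pos_tvecs n p.
               t_eigenvector n p A (complex_tvec Y) (complex_of_real (t_spectral_radius n p A))
               \<longrightarrow> (\<exists>c::real. Y = smult_tvec c X))) \<and>
         (\<forall>l. t_eigenvalue n p A l \<and>
            (\<exists>X \<in> nonneg_tvecs n p. X \<noteq> zero_tvec n p \<and> t_eigenvector n p A (complex_tvec X) l)
            \<longrightarrow> l = complex_of_real (t_spectral_radius n p A))"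
proof -
  obtain i0 j0 where pos: "i0 < n" "j0 < n" "A $$ (i0, j0) \<in> strongly_pos_tscalars p"
    using assms(5) by blast
  define S where "S = {..<n} \<times> {..<p}"
  define B where "B = bcirc p A"
  interpret nonneg_irreducible S B
  proof
    show "finite S" by (simp add: S_def)
    have "(0, 0) \<in> S" using assms(1,2) by (simp add: S_def)
    then show "S \<noteq> {}" by blast
    show "0 \<le> B s t" if "s \<in> S" "t \<in> S" for s t
      using that bcirc_nonneg[OF assms(3)] by (simp add: S_def B_def)
    show "Z = S" if "Z \<subseteq> S" "Z \<noteq> {}" "\<And>s t. s \<in> Z \<Longrightarrow> t \<in> S - Z \<Longrightarrow> B s t = 0" for Z
      using bcirc_irreducible[OF assms(3,4) pos] that unfolding S_def B_def by blast
  qed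
  have eigenvector_real: "t_eigenvector n p A (complex_tvec X) l \<longleftrightarrow>
      (\<exists>s\<in>S. flat X s \<noteq> 0) \<and> (\<forall>s\<in>S. complex_of_real (mv (flat X) s) = l * complex_of_real (flat X s))"
    if X: "X \<in> carrier_tvec n p" for X l
    using t_eigenvector_iff[OF assms(3) complex_tvec_carrier[OF X], of l] flat_complex_tvec[OF X]
    unfolding S_def[symmetric] B_def[symmetric] by (simp add: mv_def cong: sum.cong)
  obtain r x where r: "0 \<le> r" and x: "\<And>s. s \<in> S \<Longrightarrow> 0 < x s" "\<And>s. s \<in> S \<Longrightarrow> mv x s = r * x s"
    using ex_pos_eigenvector by blast
  \<comment> \<open>The locale admits the zero matrix on a one-element \<open>S\<close>, so the
    strongly positive entry is used again: it makes row \<open>(i0, 0)\<close> of the product with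
    \<open>x\<close> positive.\<close>
  have "r \<noteq> 0"
  proof
    assume "r = 0"
    have st: "(i0, 0) \<in> S" "(j0, 0) \<in> S" using pos(1,2) assms(2) by (simp_all add: S_def)
    then have "B (i0, 0) (j0, 0) * x (j0, 0) = 0"
      using x(2)[OF st(1)] \<open>r = 0\<close> sum_nonneg_eq_0_iff[OF finite_S, of "\<lambda>t. B (i0, 0) t * x t"]
        nonneg[OF st(1)] less_imp_le[OF x(1)] by (simp add: mv_def)
    moreover have "0 < B (i0, 0) (j0, 0)"
      using pos(3) assms(2) by (simp add: B_def bcirc_def strongly_pos_tscalars_def)
    ultimately show False using x(1)[OF st(2)] by simp
  qed
  define X where "X = unflat n p x"
  have X: "X \<in> carrier_tvec n p" by (simp add: X_def)
  have flat_X: "flat X s = x s" if "s \<in> S" for s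
    using that by (simp add: X_def S_def flat_unflat)
  have X_pos: "X \<in> strongly_pos_tvecs n p"
    using X x(1) flat_X by (simp add: strongly_pos_tvecs_iff flip: S_def)
  have X_eig: "t_eigenvector n p A (complex_tvec X) (complex_of_real r)"
    unfolding eigenvector_real[OF X]
  proof (intro conjI ballI)
    obtain s where "s \<in> S" using nonempty_S by blast
    then show "\<exists>s\<in>S. flat X s \<noteq> 0" using flat_X x(1)[of s] by (intro bexI[of _ s]) auto
    show "complex_of_real (mv (flat X) s) = complex_of_real r * complex_of_real (flat X s)"
      if "s \<in> S" for s
      using mv_cong[of "flat X" x s] flat_X x(2) that by simp
  qed
  have r_eig: "t_eigenvalue n p A (complex_of_real r)"
    using X_eig by (auto simp: t_eigenvalue_def)
  have radius: "t_spectral_radius n p A = r"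
    unfolding t_spectral_radius_def
  \<comment> \<open>The value \<open>r\<close> is attained by \<open>X\<close>, and comparison with
    the positive vector \<open>x\<close> bounds every other modulus.\<close>
  proof (rule Max_eqI)
    have "{cmod l | l. t_eigenvalue n p A l} = cmod ` {l. t_eigenvalue n p A l}" by blast
    moreover have "finite {l. t_eigenvalue n p A l}"
      unfolding t_eigenvalue_iff[OF assms(3)] by (rule finite_eigenvalues) simp
    ultimately show "finite {cmod l | l. t_eigenvalue n p A l}" by simp
    have "cmod (complex_of_real r) = r" using r by simp
    with r_eig show "r \<in> {cmod l | l. t_eigenvalue n p A l}" by force
    fix y assume "y \<in> {cmod l | l. t_eigenvalue n p A l}"
    then obtain l where l: "y = cmod l" "t_eigenvalue n p A l" by blast
    then obtain v where "\<exists>s\<in>S. v s \<noteq> 0"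
      "\<And>s. s \<in> S \<Longrightarrow> (\<Sum>t\<in>S. complex_of_real (B s t) * v t) = l * v s"
      unfolding t_eigenvalue_iff[OF assms(3)] S_def[symmetric] B_def[symmetric] by blast
    with l x show "y \<le> r" using eigenvalue_le by blast
  qed
  have Y_pos: "Y \<in> strongly_pos_tvecs n p"
    if Y: "Y \<in> nonneg_tvecs n p" "t_eigenvector n p A (complex_tvec Y) l" for Y l
  proof -
    have Yc: "Y \<in> carrier_tvec n p" and nn: "\<And>s. s \<in> S \<Longrightarrow> 0 \<le> flat Y s"
      using Y(1) by (simp_all add: nonneg_tvecs_iff flip: S_def)
    note E = Y(2)[unfolded eigenvector_real[OF Yc]]
    have "0 < flat Y s" if "s \<in> S" for s
    proof (rule pos_if_zeros_preserved[OF nn _ _ that])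
      show "\<exists>s\<in>S. flat Y s \<noteq> 0" using E by blast
      \<comment> \<open>Although \<open>l\<close> may be complex a priori, the right-hand side of
        the eigenvector equation is 0 at a zero of \<open>Y\<close>.\<close>
      show "mv (flat Y) s = 0" if "s \<in> S" "flat Y s = 0" for s
        using E that by (metis mult_zero_right of_real_0 of_real_eq_0_iff)
    qed
    with Yc show ?thesis by (simp add: strongly_pos_tvecs_iff flip: S_def)
  qed
  have l_eq: "l = complex_of_real r"
    if Y: "Y \<in> strongly_pos_tvecs n p" "t_eigenvector n p A (complex_tvec Y) l" for Y l
  proof -
    have Yc: "Y \<in> carrier_tvec n p" and pos: "\<And>s. s \<in> S \<Longrightarrow> 0 < flat Y s"
      using Y(1) by (simp_all add: strongly_pos_tvecs_iff flip: S_def)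
    note E = Y(2)[unfolded eigenvector_real[OF Yc]]
    obtain s0 where s0: "s0 \<in> S" using nonempty_S by blast
    \<comment> \<open>A single positive coordinate exhibits \<open>l\<close> as a quotient of two
      reals, so the real comparison lemma becomes applicable.\<close>
    define q where "q = mv (flat Y) s0 / flat Y s0"
    have "complex_of_real (mv (flat Y) s0) = l * complex_of_real (flat Y s0)" using E s0 by blast
    then have l: "l = complex_of_real q"
      using pos[OF s0] by (simp add: q_def)
    have "mv (flat Y) s = q * flat Y s" if "s \<in> S" for s
      using E that unfolding l by (metis of_real_eq_iff of_real_mult)
    then have "q = r" using x pos pos_eigenvectors_same_eigenvalue[of x r "flat Y" q] by blast
    with l show ?thesis by simp
  qed
  have unique: "\<exists>c. Y = smult_tvec c X"
    if Y: "Y \<in> strongly_pos_tvecs n p" "t_eigenvector n p A (complex_tvec Y) (complex_of_real r)" for Y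
  proof -
    have Yc: "Y \<in> carrier_tvec n p"
      using Y(1) by (simp add: strongly_pos_tvecs_iff)
    note E = Y(2)[unfolded eigenvector_real[OF Yc]]
    have "mv (flat Y) s = r * flat Y s" if "s \<in> S" for s
      using E that by (metis of_real_eq_iff of_real_mult)
    then obtain c where "\<And>s. s \<in> S \<Longrightarrow> flat Y s = c * x s"
      using x pos_eigenvector_unique[of x r "flat Y"] by blast
    then have "Y = smult_tvec c X"
      using flat_smult_tvec[OF X] flat_X
      unfolding tvec_eq_iff[OF Yc smult_tvec_carrier[OF X]] by (simp flip: S_def)
    then show ?thesis by blast
  qed
  show ?thesis
    unfolding radius
  proof (intro conjI)
    show "0 < r" using r \<open>r \<noteq> 0\<close> by simp
    show "\<exists>X \<in> strongly_pos_tvecs n p.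
        t_eigenvector n p A (complex_tvec X) (complex_of_real r) \<and>
        (\<forall>Y \<in> strongly_pos_tvecs n p.
          t_eigenvector n p A (complex_tvec Y) (complex_of_real r) \<longrightarrow> (\<exists>c. Y = smult_tvec c X))"
      using X_eig unique by (intro bexI[OF _ X_pos]) blast
  \<comment> \<open>The last claim combines both facts: \<open>Y_pos\<close> makes the nonnegative
    eigenvector strongly positive, and \<open>l_eq\<close> then identifies its eigenvalue.\<close>
  qed (use r_eig Y_pos l_eq in blast)+
qed

end
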